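(* Assume that $f(\bm{x})=\sum_{i=1}^N f_i(x_i)$ is $c_0$-strongly convex on $\mathbb{R}^{nN}$ for some $c_0>0$ and twice continuously differentiable, and that the graph $\mathcal{G}$ with Laplacian $L$ is strongly connected and weight-balanced; let $\bm{L}=L\otimes I_n$. Let $\varepsilon_0>0$ be such that for every $\varepsilon\in(0,\varepsilon_0)$ the system $$\dot{\bm{x}}=-\nabla f(\bm{x})-\bm{\lambda},\qquad \varepsilon\dot{\bm{\lambda}}=-\bm{L}\bm{\lambda}+\varepsilon(\bm{x}-\bm{b})$$ has a unique equilibrium $(\bar{\bm{x}}(\varepsilon),\bar{\bm{\lambda}}(\varepsilon))\in\mathbb{R}^{nN}\times\mathbb{R}^{nN}$. Then for every $\varepsilon\in(0,\varepsilon_0)$ the system converges to its equilibrium: every solution $(\bm{x}(t),\bm{\lambda}(t))$, $t\ge 0$, from any initial point satisfies $(\bm{x}(t),\bm{\lambda}(t))\to(\bar{\bm{x}}(\varepsilon),\bar{\bm{\lambda}}(\varepsilon))$ as $t\to\infty$. Furthermore, if the gradient map $\nabla f$ is $\kappa$-Lipschitz continuous on $\mathbb{R}^{nN}$ for some constant $\kappa>0$, then for every $\varepsilon\in(0,\varepsilon_0)$ the system converges exponentially to its equilibrium: there are constants $C,\alpha>0$ (possibly depending on $\varepsilon$) such that every solution satisfies, for all $t\ge0$, $$\|\bm{x}(t)-\bar{\bm{x}}(\varepsilon)\|+\|\bm{\lambda}(t)-\bar{\bm{\lambda}}(\varepsilon)\|\le C e^{-\alpha t}\big(\|\bm{x}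(0)-\bar{\bm{x}}(\varepsilon)\|+\|\bm{\lambda}(0)-\bar{\bm{\lambda}}(\varepsilon)\|\big).$$
   Context: Setting: $N$ agents, each with a decision variable $x_i\in\mathbb{R}^n$, a cost function $f_i:\mathbb{R}^n\to\mathbb{R}$ and a vector $b_i\in\mathbb{R}^n$. Write $\bm{x}=(x_1^T,\dots,x_N^T)^T$, $\bm{\lambda}=(\lambda_1^T,\dots,\lambda_N^T)^T$, $\bm{b}=(b_1^T,\dots,b_N^T)^T\in\mathbb{R}^{nN}$, and $d=\sum_{i=1}^N b_i$. The resource allocation problem is to minimize $f(\bm{x})=\sum_{i=1}^N f_i(x_i)$ subject to $\sum_{i=1}^N x_i=d$. An equilibrium is a pair satisfying $0=\nabla f(\bm{x})+\bm{\lambda}$ and $0=-\varepsilon(\bm{x}-\bm{b})+\bm{L}\bm{\lambda}$. It is known that under the stated assumptions an $\varepsilon_0$ as described exists. Graph: $\mathcal{G}$ is a weighted directed graph on $\{1,\dots,N\}$ with adjacency matrix $\mathcal{A}=[a_{ij}]$, where $a_{ij}>0$ if $(j,i)$ is an edge and $a_{ij}=0$ otherwise. Its Laplacian is $L=\mathcal{D}_{in}-\mathcal{A}$ with $\mathcal{D}_{in}=\mathrm{diag}(d_{in}^1,\dots,d_{in}^N)$, $d_{in}^i=\sum_j a_{ij}$. The graph is weight-balanced if $\sum_j a_{ij}=\sum_j a_{ji}$ for all $i$, and strongly connected if there is a directed path between every ordered pair of vertices. $\otimes$ is the Kronecker product, $I_n$ the $n\times n$ identity matrix, $\|\cdot\|$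 the Euclidean norm. *)

theory Defs
  imports "HOL-Analysis.Analysis"
begin

text \<open>
  The space \<open>\<real>\<^bsup>nN\<^esup>\<close> of stacked vectors is \<^typ>\<open>real ^ ('m \<times> 'n)\<close>, where \<open>'m\<close> indexes the
  agents and \<open>'n\<close> the coordinates of one agent's decision variable.
\<close>

definition stack :: "('m \<Rightarrow> real ^ 'n) \<Rightarrow> real ^ ('m::finite \<times> 'n::finite)"
  where "stack v = (\<chi> p. v (fst p) $ snd p)"

definition block :: "real ^ ('m::finite \<times> 'n::finite) \<Rightarrow> 'm \<Rightarrow> real ^ 'n"
  where "block x i = (\<chi> k. x $ (i, k))"

definition kronecker ::
  "real ^ 'b ^ 'a \<Rightarrow> real ^ 'd ^ 'c \<Rightarrow> real ^ ('b::finite \<times> 'd::finite) ^ ('a::finite \<times> 'c::finite)"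
  where "kronecker A B = (\<chi> p q. A $ fst p $ fst q * B $ snd p $ snd q)"

definition total_cost ::
  "('m \<Rightarrow> real ^ 'n \<Rightarrow> real) \<Rightarrow> real ^ ('m::finite \<times> 'n::finite) \<Rightarrow> real"
  where "total_cost fs x = (\<Sum>i\<in>UNIV. fs i (block x i))"


text \<open>The edge \<open>(j, i)\<close> carries the weight in row \<open>i\<close> and column \<open>j\<close>.\<close>

definition is_adjacency_matrix :: "('m \<times> 'm) set \<Rightarrow> real ^ 'm ^ 'm::finite \<Rightarrow> bool"
  where "is_adjacency_matrix E A \<longleftrightarrow>
    (\<forall>i j. if (j, i) \<in> E then A $ i $ j > 0 else A $ i $ j = 0)"

definition in_degree :: "real ^ 'm ^ 'm::finite \<Rightarrow> 'm \<Rightarrow> real"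
  where "in_degree A i = (\<Sum>j\<in>UNIV. A $ i $ j)"

definition laplacian :: "real ^ 'm ^ 'm::finite \<Rightarrow> real ^ 'm ^ 'm"
  where "laplacian A = (\<chi> i j. if i = j then in_degree A i else 0) - A"

definition weight_balanced :: "real ^ 'm ^ 'm::finite \<Rightarrow> bool"
  where "weight_balanced A \<longleftrightarrow> (\<forall>i. (\<Sum>j\<in>UNIV. A $ i $ j) = (\<Sum>j\<in>UNIV. A $ j $ i))"

definition strongly_connected :: "('m \<times> 'm) set \<Rightarrow> bool"
  where "strongly_connected E \<longleftrightarrow> (\<forall>i j. (i, j) \<in> E\<^sup>*)"


definition strongly_convex_on :: "'a::real_normed_vector set \<Rightarrow> real \<Rightarrow> ('a \<Rightarrow> real) \<Rightarrow> bool"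
  where "strongly_convex_on S c f \<longleftrightarrow> convex S \<and>
    (\<forall>x\<in>S. \<forall>y\<in>S. \<forall>t\<in>{0..1}.
       f (t *\<^sub>R x + (1 - t) *\<^sub>R y)
         \<le> t * f x + (1 - t) * f y - c / 2 * t * (1 - t) * (norm (x - y))\<^sup>2)"

definition twice_continuously_differentiable ::
  "('a::real_normed_vector \<Rightarrow> 'b::real_normed_vector) \<Rightarrow> bool"
  where "twice_continuously_differentiable f \<longleftrightarrow>
    (\<exists>(f' :: 'a \<Rightarrow> 'a \<Rightarrow>\<^sub>L 'b) (f'' :: 'a \<Rightarrow> 'a \<Rightarrow>\<^sub>L ('a \<Rightarrow>\<^sub>L 'b)).
       (\<forall>x. (f has_derivative blinfun_apply (f' x)) (at x)) \<and>
       (\<forall>x. (f' has_derivative blinfun_apply (f'' x)) (at x)) \<and>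
       continuous_on UNIV f'')"

text \<open>Meaningful only at points where \<open>f\<close> is differentiable.\<close>

definition gradient :: "('a::real_inner \<Rightarrow> real) \<Rightarrow> 'a \<Rightarrow> 'a"
  where "gradient f x = (THE D. GDERIV f x :> D)"

lemma gradient_eq:
  assumes "GDERIV f x :> D"
  shows "gradient f x = D"
  unfolding gradient_def
proof (rule the_equality[where P = "\<lambda>D. GDERIV f x :> D", OF assms])
  fix D' assume "GDERIV f x :> D'"
  then have "(\<lambda>h. h \<bullet> D') = (\<lambda>h. h \<bullet> D)"
    using assms unfolding gderiv_def by (rule has_derivative_unique)
  then show "D' = D"
    by (metis inner_commute vector_eq_rdot)
qed


text \<open>
  Below, \<open>f\<close> is the total cost, \<open>L\<close> the matrix acting on the stacked multipliers and
  \<open>b\<close> the stacked resource vector.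
\<close>

definition is_equilibrium ::
  "(real ^ 'k \<Rightarrow> real) \<Rightarrow> real ^ 'k ^ 'k \<Rightarrow> real ^ 'k \<Rightarrow> real
    \<Rightarrow> (real ^ 'k::finite) \<times> (real ^ 'k) \<Rightarrow> bool"
  where "is_equilibrium f L b \<epsilon> = (\<lambda>(x, \<mu>).
    0 = gradient f x + \<mu> \<and> 0 = - (\<epsilon> *\<^sub>R (x - b)) + L *v \<mu>)"

text \<open>Solutions live on \<open>{0..}\<close>; the derivative at \<open>0\<close> is one-sided.\<close>

definition is_solution ::
  "(real ^ 'k \<Rightarrow> real) \<Rightarrow> real ^ 'k ^ 'k \<Rightarrow> real ^ 'k \<Rightarrow> real
    \<Rightarrow> (real \<Rightarrow> real ^ 'k::finite) \<Rightarrow> (real \<Rightarrow> real ^ 'k) \<Rightarrow> bool"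
  where "is_solution f L b \<epsilon> x \<mu> \<longleftrightarrow> (\<forall>t\<ge>0.
    (x has_vector_derivative - gradient f (x t) - \<mu> t) (at t within {0..}) \<and>
    (\<exists>\<mu>'. (\<mu> has_vector_derivative \<mu>') (at t within {0..}) \<and>
      \<epsilon> *\<^sub>R \<mu>' = - (L *v \<mu> t) + \<epsilon> *\<^sub>R (x t - b)))"

end

theory Submission
  imports Defs
begin

text \<open>
  In the error coordinates \<open>u = x - xbar\<close>, \<open>v = \<mu> - \<mu>bar\<close> the system reads
  \<open>u' = - g - v\<close>, \<open>v' = u - h\<close> with \<open>g = gradient f x - gradient f xbar\<close> and
  \<open>h = L v / \<epsilon>\<close>. Strong convexity gives \<open>u \<bullet> g \<ge> c0 |u|\<^sup>2\<close>, and weight balance makes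
  \<open>v \<bullet> h \<ge> 0\<close>, so \<open>|u|\<^sup>2 + |v|\<^sup>2\<close> does not increase. If moreover \<open>|g| \<le> K |u|\<close> along the
  trajectory, then for small \<open>\<delta>\<close> the function \<open>(|u|\<^sup>2 + |v|\<^sup>2) / 2 + \<delta> u \<bullet> v\<close> decays
  exponentially, because the cross term contributes \<open>- \<delta> |v|\<^sup>2\<close>. A global Lipschitz constant of the
  gradient serves as \<open>K\<close> for all solutions at once; without one, a single bounded trajectory stays in a
  ball on which the \<open>C\<^sup>1\<close> gradient is Lipschitz.
\<close>

section \<open>Differential inequalities and derivatives of inner products\<close>

text \<open>With the integrating factor \<open>exp (a * s)\<close>, the product
  \<open>exp (a * s) * W s\<close> has nonpositive derivative. The sign of \<open>a\<close> is left
  open, so \<open>a = 0\<close> gives plain monotonicity.\<close>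

lemma exp_decay_of_deriv_le:
  fixes W W' :: "real \<Rightarrow> real"
  assumes deriv: "\<And>t. t \<ge> 0 \<Longrightarrow> (W has_real_derivative W' t) (at t within {0..})"
    and le: "\<And>t. t \<ge> 0 \<Longrightarrow> W' t \<le> - a * W t"
    and "t \<ge> 0"
  shows "W t \<le> exp (- a * t) * W 0"
proof -
  let ?F = "\<lambda>s. exp (a * s) * W s"
  have F: "(?F has_real_derivative exp (a * s) * (W' s + a * W s)) (at s within {0..})"
    if "s \<ge> 0" for s
    by (auto intro!: derivative_eq_intros deriv[OF that] simp: algebra_simps)
  have "?F t \<le> ?F 0"
  \<comment> \<open>Two-sided derivatives are needed only for \<open>0 < s < t\<close>; at
    \<open>0\<close>, where the derivative is one-sided, continuity is enough.\<close>
  proof (rule DERIV_nonpos_imp_decreasing_open[OF \<open>t \<ge> 0\<close>])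
    fix s :: real
    assume s: "0 < s" "s < t"
    have "at s within {0..} = at s"
      using s by (intro at_within_interior) simp
    moreover have "exp (a * s) * (W' s + a * W s) \<le> 0"
      using le[of s] s by (intro mult_nonneg_nonpos) auto
    ultimately show "\<exists>y. (?F has_real_derivative y) (at s) \<and> y \<le> 0"
      using F[of s] s by auto
  next
    have "continuous_on {0..} ?F"
      by (rule DERIV_continuous_on) (use F in auto)
    then show "continuous_on {0..t} ?F"
      by (rule continuous_on_subset) auto
  qed
  then show ?thesis
    by (simp add: exp_minus field_simps)
qed

lemma has_real_derivative_inner:
  assumes "(p has_vector_derivative p') (at t within S)"
    and "(q has_vector_derivative q') (at t within S)"
  shows "((\<lambda>s. p s \<bullet> q s) has_real_derivative p t \<bullet> q' + p' \<bullet> q t) (at t within S)"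
  using has_derivative_inner[OF assms[unfolded has_vector_derivative_def]]
  by (simp add: has_field_derivative_def distrib_left[symmetric] add.commute mult_commute_abs)

section \<open>Lyapunov analysis of the error system\<close>

text \<open>\<open>g\<close> and \<open>h\<close> are bare functions of time, so growth bounds can
  be imposed along a single trajectory; global and local Lipschitz constants are then treated
  alike.\<close>

locale dissipative_pair =
  fixes u v g h :: "real \<Rightarrow> 'a::real_inner" and c :: real
  assumes u_deriv: "t \<ge> 0 \<Longrightarrow> (u has_vector_derivative - g t - v t) (at t within {0..})"
    and v_deriv: "t \<ge> 0 \<Longrightarrow> (v has_vector_derivative u t - h t) (at t within {0..})"
    and c_pos: "c > 0"
    and coercive: "t \<ge> 0 \<Longrightarrow> c * (u t \<bullet> u t) \<le> u t \<bullet> g t"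
    and dissipative: "t \<ge> 0 \<Longrightarrow> 0 \<le> v t \<bullet> h t"
begin

text \<open>The coupling \<open>- v\<close> in \<open>u'\<close> and \<open>u\<close> in
  \<open>v'\<close> is skew and cancels, leaving the derivative
  \<open>- 2 * (u t \<bullet> g t) - 2 * (v t \<bullet> h t)\<close>. This confines a trajectory
  before any Lipschitz constant is known.\<close>

lemma energy_le:
  assumes "t \<ge> 0"
  shows "u t \<bullet> u t + v t \<bullet> v t \<le> u 0 \<bullet> u 0 + v 0 \<bullet> v 0"
proof -
  let ?W = "\<lambda>t. u t \<bullet> u t + v t \<bullet> v t"
  let ?W' = "\<lambda>t. (u t \<bullet> (- g t - v t) + (- g t - v t) \<bullet> u t) + (v t \<bullet> (u t - h t) + (u t - h t) \<bullet> v t)"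
  have "?W t \<le> exp (- 0 * t) * ?W 0"
  proof (rule exp_decay_of_deriv_le[where W' = ?W', OF _ _ assms])
    fix t :: real
    assume t: "t \<ge> 0"
    show "(?W has_real_derivative ?W' t) (at t within {0..})"
      by (intro DERIV_add has_real_derivative_inner u_deriv v_deriv t)
    have "0 \<le> u t \<bullet> g t"
      using coercive[OF t] c_pos inner_ge_zero[of "u t"]
      by (meson mult_nonneg_nonneg order.trans less_imp_le)
    then show "?W' t \<le> - 0 * ?W t"
      using dissipative[OF t] by (simp add: inner_diff inner_commute)
  qed
  then show ?thesis by simp
qed

text \<open>The bound \<open>\<delta> \<le> 1/2\<close> keeps the perturbed energy \<open>?W\<close>
  comparable with \<open>?E\<close>; the third condition lets the coercivity of \<open>g\<close>
  absorb what the cross term adds in \<open>u\<close>. \<open>?W\<close> decays at rate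
  \<open>\<delta>/2\<close>, and the square root taken to return to norms halves this to
  \<open>\<delta>/4\<close>.\<close>

lemma exponential_decay:
  assumes g_le: "\<And>t. t \<ge> 0 \<Longrightarrow> norm (g t) \<le> K * norm (u t)"
    and h_le: "\<And>t. t \<ge> 0 \<Longrightarrow> norm (h t) \<le> l * norm (v t)"
    and \<delta>: "0 < \<delta>" "\<delta> \<le> 1/2" "\<delta> * (2 + (K + l)\<^sup>2) \<le> c"
    and "t \<ge> 0"
  shows "norm (u t) + norm (v t) \<le> 3 * exp (- (\<delta>/4) * t) * (norm (u 0) + norm (v 0))"
proof -
  let ?E = "\<lambda>t. u t \<bullet> u t + v t \<bullet> v t"
  let ?W = "\<lambda>t. ?E t / 2 + \<delta> * (u t \<bullet> v t)"
  let ?W' = "\<lambda>t. ((u t \<bullet> (- g t - v t) + (- g t - v t) \<bullet> u t) + (v t \<bullet> (u t - h t) + (u t - h t) \<bullet> v t)) / 2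
      + \<delta> * (u t \<bullet> (u t - h t) + (- g t - v t) \<bullet> v t)"
  have cross: "\<bar>u t \<bullet> v t\<bar> \<le> ?E t / 2" for t
    using inner_ge_zero[of "u t + v t"] inner_ge_zero[of "u t - v t"]
    by (simp add: inner_add inner_diff inner_commute abs_le_iff)
  have E_nonneg: "0 \<le> ?E t" for t
    by simp
  have \<delta>_cross: "\<bar>\<delta> * (u t \<bullet> v t)\<bar> \<le> ?E t / 4" for t
  proof -
    have "\<bar>\<delta> * (u t \<bullet> v t)\<bar> \<le> (1/2) * (?E t / 2)"
      unfolding abs_mult using \<delta> cross[of t] by (intro mult_mono) auto
    then show ?thesis by simp
  qed
  \<comment> \<open>The cross term is at most a quarter of \<open>?E\<close>, so \<open>?W\<close>
    lies between \<open>?E / 4\<close> and \<open>3 * ?E / 4\<close>; the coarser upper bound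
    \<open>?E\<close> suffices.\<close>
  have W_lower: "?E t \<le> 4 * ?W t" for t
    using \<delta>_cross[of t] by (simp only: abs_le_iff) argo
  have W_upper: "?W t \<le> ?E t" for t
    using \<delta>_cross[of t] E_nonneg[of t] by (simp only: abs_le_iff) argo
  have W_deriv_le: "?W' t \<le> - (\<delta>/2) * ?W t" if t: "t \<ge> 0" for t
  proof -
    let ?a = "norm (u t)" and ?b = "norm (v t)"
    have "- (g t \<bullet> v t) \<le> (K * ?a) * ?b"
      using Cauchy_Schwarz_ineq2[of "g t" "v t"] mult_right_mono[OF g_le[OF t], of ?b]
      by auto
    moreover have "- (u t \<bullet> h t) \<le> ?a * (l * ?b)"
      using Cauchy_Schwarz_ineq2[of "u t" "h t"] mult_left_mono[OF h_le[OF t], of ?a]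
      by auto
    ultimately have "- (g t \<bullet> v t) - u t \<bullet> h t \<le> (K + l) * ?a * ?b"
      by (simp add: algebra_simps)
    \<comment> \<open>Young's inequality with the whole factor \<open>K + l\<close> on the
      \<open>u\<close> side: only half of the gain \<open>- \<delta> * ?b\<^sup>2\<close> is
      spent.\<close>
    also have "\<dots> \<le> ((K + l)\<^sup>2 * ?a\<^sup>2 + ?b\<^sup>2) / 2"
      using sum_squares_bound[of "(K + l) * ?a" ?b] by (simp add: power_mult_distrib)
    finally have "\<delta> * (- (g t \<bullet> v t) - u t \<bullet> h t) \<le> \<delta> * (((K + l)\<^sup>2 * ?a\<^sup>2 + ?b\<^sup>2) / 2)"
      using \<delta> by (simp add: mult_left_mono)
    \<comment> \<open>Half of \<open>c * ?a\<^sup>2\<close> absorbs all terms in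
      \<open>?a\<^sup>2\<close> produced by the cross term; the other half, by the next bound,
      leaves \<open>- (\<delta>/2) * ?a\<^sup>2\<close>.\<close>
    moreover have "\<delta> * (2 + (K + l)\<^sup>2) * ?a\<^sup>2 \<le> c * ?a\<^sup>2"
      using \<delta> by (intro mult_right_mono) auto
    moreover have "\<delta> * ?a\<^sup>2 \<le> c * ?a\<^sup>2"
    proof (rule mult_right_mono)
      have "\<delta> * 1 \<le> \<delta> * (2 + (K + l)\<^sup>2)"
        using \<delta> by (intro mult_left_mono) auto
      then show "\<delta> \<le> c" using \<delta>(3) by linarith
    qed simp
    moreover have "\<delta> * ?W t \<le> \<delta> * (?a\<^sup>2 + ?b\<^sup>2)"
      unfolding power2_norm_eq_inner using \<delta>(1) W_upper[of t] by (intro mult_left_mono) simp_all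
    moreover have "?W' t = - (u t \<bullet> g t) - v t \<bullet> h t
        + \<delta> * (?a\<^sup>2 - ?b\<^sup>2) + \<delta> * (- (g t \<bullet> v t) - u t \<bullet> h t)"
      unfolding inner_diff_left inner_diff_right inner_minus_left inner_minus_right
        power2_norm_eq_inner inner_commute[of "v t" "u t"] inner_commute[of "g t" "u t"]
        inner_commute[of "h t" "v t"]
      by (simp add: field_simps)
    moreover have "c * ?a\<^sup>2 \<le> u t \<bullet> g t"
      using coercive[OF t] by (simp add: power2_norm_eq_inner)
    ultimately show ?thesis
      using dissipative[OF t] by argo
  qed
  have "?W t \<le> exp (- (\<delta>/2) * t) * ?W 0"
  proof (rule exp_decay_of_deriv_le[where W' = ?W', OF _ W_deriv_le \<open>t \<ge> 0\<close>])
    fix t :: real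
    assume "t \<ge> 0"
    then show "(?W has_real_derivative ?W' t) (at t within {0..})"
      by (intro DERIV_add DERIV_cdivide DERIV_cmult has_real_derivative_inner u_deriv v_deriv)
  qed
  also have "\<dots> \<le> exp (- (\<delta>/2) * t) * ?E 0"
    using W_upper by (intro mult_left_mono) auto
  finally have W_decay: "?W t \<le> exp (- (\<delta>/2) * t) * ?E 0" .
  have E_decay: "?E t \<le> 4 * (exp (- (\<delta>/2) * t) * ?E 0)"
    by (rule order_trans[OF W_lower mult_left_mono[OF W_decay]]) simp
  have "(norm (u t) + norm (v t))\<^sup>2 \<le> 2 * ?E t"
    using sum_squares_bound[of "norm (u t)" "norm (v t)"]
    by (simp add: power2_sum power2_norm_eq_inner[symmetric])
  \<comment> \<open>The factors 2 and 4 multiply to 8, rounded up to 9 so that the square root is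
    3.\<close>
  also have "\<dots> \<le> 9 * (exp (- (\<delta>/2) * t) * ?E 0)"
  proof -
    have "2 * e \<le> 9 * y" if "0 \<le> y" "e \<le> 4 * y" for e y :: real
      using that by linarith
    from this[OF _ E_decay] show ?thesis
      using E_nonneg[of 0] by simp
  qed
  also have "\<dots> \<le> 9 * (exp (- (\<delta>/2) * t) * (norm (u 0) + norm (v 0))\<^sup>2)"
    by (intro mult_left_mono) (auto simp: power2_sum power2_norm_eq_inner[symmetric])
  also have "\<dots> = (3 * exp (- (\<delta>/4) * t) * (norm (u 0) + norm (v 0)))\<^sup>2"
    by (simp add: power_mult_distrib exp_double[symmetric])
  finally show ?thesis
    by (rule power2_le_imp_le) auto
qed

end

section \<open>Gradients of strongly convex and of twice continuously differentiable
  functions\<close>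

text \<open>Divide the convexity inequality on the segment from \<open>y\<close> to \<open>x\<close>
  by \<open>t\<close> and let \<open>t\<close> tend to 0 from the right; the factor
  \<open>1 - t\<close> in \<open>?R\<close> then becomes 1.\<close>

lemma strongly_convex_gradient_ineq:
  fixes f :: "'a::real_inner \<Rightarrow> real"
  assumes "strongly_convex_on UNIV c f" and grad: "GDERIV f y :> D"
  shows "D \<bullet> (x - y) \<le> f x - f y - c/2 * (norm (x - y))\<^sup>2"
proof -
  let ?\<phi> = "\<lambda>t. f (y + t *\<^sub>R (x - y))"
  let ?R = "\<lambda>t::real. f x - f y - c/2 * (1 - t) * (norm (x - y))\<^sup>2"
  have "((\<lambda>t::real. y + t *\<^sub>R (x - y)) has_derivative (\<lambda>t. t *\<^sub>R (x - y))) (at 0)"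
    by (auto intro!: derivative_eq_intros)
  moreover have "(f has_derivative (\<lambda>h. h \<bullet> D)) (at (y + 0 *\<^sub>R (x - y)))"
    using grad by (simp add: gderiv_def)
  ultimately have "(?\<phi> has_derivative (\<lambda>t. t *\<^sub>R (x - y) \<bullet> D)) (at 0)"
    by (rule has_derivative_compose)
  then have "(?\<phi> has_real_derivative D \<bullet> (x - y)) (at 0)"
    by (simp add: has_field_derivative_def inner_commute mult_commute_abs)
  then have "((\<lambda>t. (?\<phi> t - ?\<phi> 0) / t) \<longlongrightarrow> D \<bullet> (x - y)) (at_right 0)"
    unfolding has_field_derivative_iff using filterlim_at_within_not_equal
    by (auto intro: filterlim_mono[OF _ order_refl] simp: at_le)
  moreover have "(?R \<longlongrightarrow> ?R 0) (at_right 0)"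
    by (intro tendsto_intros)
  moreover have "\<forall>\<^sub>F t in at_right 0. (?\<phi> t - ?\<phi> 0) / t \<le> ?R t"
  proof (rule eventually_at_rightI[of 0 1])
    fix t :: real
    assume t: "t \<in> {0<..<1}"
    have "?\<phi> t = f (t *\<^sub>R x + (1 - t) *\<^sub>R y)"
      by (simp add: algebra_simps)
    also have "\<dots> \<le> t * f x + (1 - t) * f y - c/2 * t * (1 - t) * (norm (x - y))\<^sup>2"
      using assms(1) t by (auto simp: strongly_convex_on_def)
    finally have "?\<phi> t - f y \<le> t * ?R t"
      by (simp add: algebra_simps)
    then show "(?\<phi> t - ?\<phi> 0) / t \<le> ?R t"
      using t by (simp add: divide_le_eq mult.commute)
  qed simp
  ultimately show ?thesis
    using tendsto_le[OF trivial_limit_at_right_real] by fastforce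
qed

text \<open>Add the first-order inequality to the one with \<open>x\<close> and \<open>y\<close>
  exchanged: the function values cancel and each contributes half of \<open>c\<close>.\<close>

lemma strongly_convex_gradient_mono:
  fixes f :: "'a::real_inner \<Rightarrow> real"
  assumes "strongly_convex_on UNIV c f" and "GDERIV f x :> D" and "GDERIV f y :> D'"
  shows "c * (norm (x - y))\<^sup>2 \<le> (x - y) \<bullet> (D - D')"
  using strongly_convex_gradient_ineq[OF assms(1,3), of x]
    strongly_convex_gradient_ineq[OF assms(1,2), of y]
  by (simp add: norm_minus_commute inner_diff inner_commute)

text \<open>\<open>?D\<close> is the Riesz representative of the derivative, written in the standard
  basis. Its existence makes the definite description in \<open>gradient\<close> meaningful.\<close>

lemma differentiable_GDERIV_gradient:
  fixes f :: "'a::euclidean_space \<Rightarrow> real"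
  assumes "f differentiable (at x)"
  shows "GDERIV f x :> gradient f x"
proof -
  obtain f' where f': "(f has_derivative f') (at x)"
    using assms by (auto simp: differentiable_def)
  interpret linear f'
    using f' by (rule has_derivative_linear)
  let ?D = "\<Sum>i\<in>Basis. f' i *\<^sub>R i"
  have "f' h = h \<bullet> ?D" for h
  proof -
    have "f' h = f' (\<Sum>i\<in>Basis. (h \<bullet> i) *\<^sub>R i)"
      by (simp add: euclidean_representation)
    also have "\<dots> = h \<bullet> ?D"
      by (simp add: sum scale inner_sum_right mult.commute)
    finally show ?thesis .
  qed
  then have "GDERIV f x :> ?D"
    using f' unfolding gderiv_def by (metis (no_types, lifting) ext)
  then show ?thesis
    using gradient_eq by metis
qed

lemma twice_continuously_differentiable_GDERIV:
  fixes f :: "'a::euclidean_space \<Rightarrow> real"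
  assumes "twice_continuously_differentiable f"
  shows "GDERIV f x :> gradient f x"
  using assms unfolding twice_continuously_differentiable_def
  by (intro differentiable_GDERIV_gradient) (auto simp: differentiable_def)

text \<open>The second derivative is bounded on the compact ball, so the mean value inequality makes
  \<open>f'\<close> Lipschitz there; the Riesz identification carries this over to the
  gradient.\<close>

lemma twice_continuously_differentiable_gradient_lipschitz_cball:
  fixes f :: "'a::euclidean_space \<Rightarrow> real"
  assumes "twice_continuously_differentiable f"
  obtains K where "K-lipschitz_on (cball a r) (gradient f)"
proof -
  obtain f' :: "'a \<Rightarrow> 'a \<Rightarrow>\<^sub>L real" and f'' :: "'a \<Rightarrow> 'a \<Rightarrow>\<^sub>L ('a \<Rightarrow>\<^sub>L real)"
    where f': "\<And>x. (f has_derivative f' x) (at x)"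
      and f'': "\<And>x. (f' has_derivative f'' x) (at x)"
      and cont: "continuous_on UNIV f''"
    using assms unfolding twice_continuously_differentiable_def by blast
  have "bounded (f'' ` cball a r)"
    using cont by (intro compact_imp_bounded compact_continuous_image)
      (auto intro: continuous_on_subset)
  then obtain B where B: "B > 0" "\<And>x. x \<in> cball a r \<Longrightarrow> norm (f'' x) \<le> B"
    unfolding bounded_pos by auto
  have "norm (gradient f x - gradient f y) \<le> B * norm (x - y)"
    if "x \<in> cball a r" "y \<in> cball a r" for x y
  proof -
    let ?D = "gradient f x - gradient f y"
    have apply_eq: "f' z h = h \<bullet> gradient f z" for z h
      using has_derivative_unique[OF f'[of z]]
        twice_continuously_differentiable_GDERIV[OF assms, of z]
      unfolding gderiv_def by metis
    \<comment> \<open>Testing the functional \<open>f' x - f' y\<close> on its own representative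
      \<open>?D\<close> bounds \<open>norm ?D\<close> by the operator norm.\<close>
    have "norm ?D * norm ?D = (f' x - f' y) ?D"
      by (simp add: apply_eq blinfun.diff_left inner_diff_right
          power2_eq_square[symmetric] power2_norm_eq_inner)
    also have "\<dots> \<le> norm (f' x - f' y) * norm ?D"
      using norm_blinfun[of "f' x - f' y" ?D] by simp
    finally have "norm ?D \<le> norm (f' x - f' y)"
      by (cases "norm ?D = 0") (auto simp: mult_le_cancel_right)
    also have "\<dots> \<le> B * norm (x - y)"
      by (rule differentiable_bound[of "cball a r" f' "\<lambda>x. blinfun_apply (f'' x)"])
        (use B that in \<open>auto simp: norm_blinfun.rep_eq[symmetric]
           intro: has_derivative_at_withinI f''\<close>)
    finally show ?thesis .
  qed
  then have "B-lipschitz_on (cball a r) (gradient f)"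
    using B by (intro lipschitz_onI) (auto simp: dist_norm)
  then show thesis by (rule that)
qed

section \<open>Positivity of the Laplacian of a weight-balanced graph\<close>

text \<open>Row sums of \<open>A\<close> weight the squares \<open>(w $ i)\<^sup>2\<close>. Balance
  lets column sums replace them, so half of the diagonal part can be moved to
  \<open>(w $ j)\<^sup>2\<close>, which completes the squares.\<close>

lemma laplacian_quadratic_form:
  fixes w :: "real ^ 'm::finite"
  assumes "weight_balanced A"
  shows "w \<bullet> (laplacian A *v w) = (\<Sum>i\<in>UNIV. \<Sum>j\<in>UNIV. A $ i $ j * (w $ i - w $ j)\<^sup>2) / 2"
proof -
  let ?S = "\<lambda>F. \<Sum>i\<in>UNIV. \<Sum>j\<in>UNIV. A $ i $ j * F i j"
  have row: "(laplacian A *v w) $ i = in_degree A i * w $ i - (\<Sum>j\<in>UNIV. A $ i $ j * w $ j)" for i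
  proof -
    have "(laplacian A *v w) $ i
        = (\<Sum>j\<in>UNIV. (if i = j then in_degree A i * w $ i else 0) - A $ i $ j * w $ j)"
      unfolding matrix_vector_mult_def laplacian_def
      by (auto intro!: sum.cong simp: left_diff_distrib)
    then show ?thesis
      by (simp add: sum_subtractf)
  qed
  have "w \<bullet> (laplacian A *v w) = ?S (\<lambda>i j. (w $ i)\<^sup>2) - ?S (\<lambda>i j. w $ i * w $ j)"
    by (simp add: inner_vec_def row in_degree_def algebra_simps sum_subtractf
        sum_distrib_left sum_distrib_right power2_eq_square)
  moreover have "?S (\<lambda>i j. (w $ j)\<^sup>2) = ?S (\<lambda>i j. (w $ i)\<^sup>2)"
  proof -
    have "?S (\<lambda>i j. (w $ j)\<^sup>2) = (\<Sum>j\<in>UNIV. (\<Sum>i\<in>UNIV. A $ i $ j) * (w $ j)\<^sup>2)"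
      by (subst sum.swap) (simp add: sum_distrib_right)
    also have "\<dots> = (\<Sum>j\<in>UNIV. (\<Sum>i\<in>UNIV. A $ j $ i) * (w $ j)\<^sup>2)"
      using assms by (simp add: weight_balanced_def)
    finally show ?thesis
      by (simp add: sum_distrib_right)
  qed
  moreover have "?S (\<lambda>i j. (w $ i - w $ j)\<^sup>2)
      = ?S (\<lambda>i j. (w $ i)\<^sup>2) + ?S (\<lambda>i j. (w $ j)\<^sup>2) - 2 * ?S (\<lambda>i j. w $ i * w $ j)"
    by (simp add: power2_diff algebra_simps sum.distrib sum_subtractf sum_distrib_left)
  ultimately show ?thesis by simp
qed

text \<open>The identity factor leaves the coordinate index \<open>k\<close> untouched, so
  \<open>M\<close> acts separately on each slice that collects the \<open>k\<close>-th coordinates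
  of all agents.\<close>

lemma inner_kronecker_mat_1:
  fixes M :: "real ^ 'm ^ 'm::finite" and v :: "real ^ ('m \<times> 'n::finite)"
  shows "v \<bullet> (kronecker M (mat 1 :: real ^ 'n ^ 'n) *v v)
    = (\<Sum>k\<in>UNIV. (\<chi> i. v $ (i, k)) \<bullet> (M *v (\<chi> i. v $ (i, k))))"
proof -
  have row: "(kronecker M (mat 1 :: real ^ 'n ^ 'n) *v v) $ (i, k) = (\<Sum>j\<in>UNIV. M $ i $ j * v $ (j, k))"
    for i k
    by (simp add: kronecker_def matrix_vector_mult_def mat_def UNIV_Times_UNIV[symmetric]
        sum.cartesian_product' if_distrib if_distribR del: UNIV_Times_UNIV cong: if_cong)
  have "v \<bullet> (kronecker M (mat 1 :: real ^ 'n ^ 'n) *v v)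
      = (\<Sum>i\<in>UNIV. \<Sum>k\<in>UNIV. v $ (i, k) * (\<Sum>j\<in>UNIV. M $ i $ j * v $ (j, k)))"
    unfolding inner_vec_def UNIV_Times_UNIV[symmetric] sum.cartesian_product'
    by (simp add: row)
  also have "\<dots> = (\<Sum>k\<in>UNIV. \<Sum>i\<in>UNIV. v $ (i, k) * (\<Sum>j\<in>UNIV. M $ i $ j * v $ (j, k)))"
    by (rule sum.swap)
  finally show ?thesis
    by (simp add: inner_vec_def matrix_vector_mult_def)
qed

lemma kronecker_laplacian_nonneg:
  fixes v :: "real ^ ('m::finite \<times> 'n::finite)"
  assumes "is_adjacency_matrix E A" and "weight_balanced A"
  shows "0 \<le> v \<bullet> (kronecker (laplacian A) (mat 1 :: real ^ 'n ^ 'n) *v v)"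
proof -
  have "0 \<le> A $ i $ j" for i j
    using assms(1) unfolding is_adjacency_matrix_def by (metis less_imp_le order_refl)
  then show ?thesis
    unfolding inner_kronecker_mat_1 laplacian_quadratic_form[OF assms(2)]
    by (auto intro!: sum_nonneg)
qed

section \<open>From solutions to error dynamics\<close>

text \<open>Subtracting the equilibrium equations removes \<open>b\<close> and the constant terms.
  Of the matrix, only the sign of its quadratic form enters.\<close>

lemma solution_dissipative_pair:
  fixes f :: "real ^ 'k::finite \<Rightarrow> real"
  assumes "c > 0" and "strongly_convex_on UNIV c f"
    and grad: "\<And>x. GDERIV f x :> gradient f x"
    and L: "\<And>v. 0 \<le> v \<bullet> (L *v v)" and "\<epsilon> > 0"
    and eq: "is_equilibrium f L b \<epsilon> (xbar, \<mu>bar)"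
    and sol: "is_solution f L b \<epsilon> x \<mu>"
  shows "dissipative_pair (\<lambda>t. x t - xbar) (\<lambda>t. \<mu> t - \<mu>bar)
    (\<lambda>t. gradient f (x t) - gradient f xbar) (\<lambda>t. (1/\<epsilon>) *\<^sub>R (L *v (\<mu> t - \<mu>bar))) c"
proof
  have \<mu>bar: "\<mu>bar = - gradient f xbar"
    using eq by (simp add: is_equilibrium_def eq_neg_iff_add_eq_0 add.commute)
  have Lbar: "L *v \<mu>bar = \<epsilon> *\<^sub>R (xbar - b)"
    using eq by (simp add: is_equilibrium_def)
  fix t :: real
  assume "t \<ge> 0"
  then obtain \<mu>' where x': "(x has_vector_derivative - gradient f (x t) - \<mu> t) (at t within {0..})"
    and \<mu>': "(\<mu> has_vector_derivative \<mu>') (at t within {0..})"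
    and \<mu>'_eq: "\<epsilon> *\<^sub>R \<mu>' = - (L *v \<mu> t) + \<epsilon> *\<^sub>R (x t - b)"
    using sol unfolding is_solution_def by blast
  show "((\<lambda>t. x t - xbar) has_vector_derivative
      - (gradient f (x t) - gradient f xbar) - (\<mu> t - \<mu>bar)) (at t within {0..})"
    using has_vector_derivative_diff[OF x' has_vector_derivative_const] \<mu>bar by simp
  \<comment> \<open>The solution predicate fixes only \<open>\<epsilon> *\<^sub>R \<mu>'\<close>, so
    the error equation is first found in this scaled form and then divided by
    \<open>\<epsilon>\<close>.\<close>
  have error_eq: "\<epsilon> *\<^sub>R \<mu>' = \<epsilon> *\<^sub>R (x t - xbar) - L *v (\<mu> t - \<mu>bar)"
    unfolding \<mu>'_eq by (simp add: matrix_vector_mult_diff_distrib Lbar algebra_simps)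
  have "\<mu>' = (1/\<epsilon>) *\<^sub>R (\<epsilon> *\<^sub>R \<mu>')"
    using \<open>\<epsilon> > 0\<close> by simp
  also have "\<dots> = (1/\<epsilon>) *\<^sub>R (\<epsilon> *\<^sub>R (x t - xbar) - L *v (\<mu> t - \<mu>bar))"
    by (simp only: error_eq)
  also have "\<dots> = x t - xbar - (1/\<epsilon>) *\<^sub>R (L *v (\<mu> t - \<mu>bar))"
    using \<open>\<epsilon> > 0\<close> by (simp add: scaleR_diff_right)
  finally show "((\<lambda>t. \<mu> t - \<mu>bar) has_vector_derivative
      x t - xbar - (1/\<epsilon>) *\<^sub>R (L *v (\<mu> t - \<mu>bar))) (at t within {0..})"
    using has_vector_derivative_diff[OF \<mu>' has_vector_derivative_const] by simp
  show "c * ((x t - xbar) \<bullet> (x t - xbar)) \<le> (x t - xbar) \<bullet> (gradient f (x t) - gradient f xbar)"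
    using strongly_convex_gradient_mono[OF assms(2) grad grad]
    by (simp add: power2_norm_eq_inner)
  show "0 \<le> (\<mu> t - \<mu>bar) \<bullet> (1/\<epsilon>) *\<^sub>R (L *v (\<mu> t - \<mu>bar))"
    using L[of "\<mu> t - \<mu>bar"] \<open>\<epsilon> > 0\<close> by simp
qed (rule \<open>c > 0\<close>)

section \<open>Convergence to the equilibrium\<close>

theorem theorem2:
  fixes fs :: "'m::finite \<Rightarrow> real ^ 'n::finite \<Rightarrow> real"
    and bs :: "'m \<Rightarrow> real ^ 'n"
    and E :: "('m \<times> 'm) set"
    and A :: "real ^ 'm ^ 'm"
    and c0 \<epsilon>0 :: real
    and xbar \<mu>bar :: "real \<Rightarrow> real ^ ('m \<times> 'n)"
  defines "f \<equiv> total_cost fs"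
    and "b \<equiv> stack bs"
    and "L \<equiv> kronecker (laplacian A) (mat 1 :: real ^ 'n ^ 'n)"
  assumes "c0 > 0"
    and "strongly_convex_on UNIV c0 f"
    and "twice_continuously_differentiable f"
    and "is_adjacency_matrix E A"
    and "strongly_connected E"
    and "weight_balanced A"
    and "\<epsilon>0 > 0"
    and "\<forall>\<epsilon>\<in>{0<..<\<epsilon>0}. \<exists>!p. is_equilibrium f L b \<epsilon> p"
    and "\<forall>\<epsilon>\<in>{0<..<\<epsilon>0}. is_equilibrium f L b \<epsilon> (xbar \<epsilon>, \<mu>bar \<epsilon>)"
  shows "(\<forall>\<epsilon>\<in>{0<..<\<epsilon>0}. \<forall>x \<mu>. is_solution f L b \<epsilon> x \<mu> \<longrightarrow>
            ((\<lambda>t. (x t, \<mu> t)) \<longlongrightarrow> (xbar \<epsilon>, \<mu>bar \<epsilon>)) at_top)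
       \<and> ((\<exists>\<kappa>>0. \<kappa>-lipschitz_on UNIV (gradient f)) \<longrightarrow>
          (\<forall>\<epsilon>\<in>{0<..<\<epsilon>0}. \<exists>C>0. \<exists>\<alpha>>0. \<forall>x \<mu>. is_solution f L b \<epsilon> x \<mu> \<longrightarrow>
            (\<forall>t\<ge>0. norm (x t - xbar \<epsilon>) + norm (\<mu> t - \<mu>bar \<epsilon>)
              \<le> C * exp (- \<alpha> * t) * (norm (x 0 - xbar \<epsilon>) + norm (\<mu> 0 - \<mu>bar \<epsilon>)))))"
proof -
  have grad: "GDERIV f x :> gradient f x" for x
    using assms(6) by (rule twice_continuously_differentiable_GDERIV)
  have L_nonneg: "0 \<le> v \<bullet> (L *v v)" for v
    unfolding L_def using assms(7,9) by (rule kronecker_laplacian_nonneg)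
  have pair: "dissipative_pair (\<lambda>t. x t - xbar \<epsilon>) (\<lambda>t. \<mu> t - \<mu>bar \<epsilon>)
      (\<lambda>t. gradient f (x t) - gradient f (xbar \<epsilon>)) (\<lambda>t. (1/\<epsilon>) *\<^sub>R (L *v (\<mu> t - \<mu>bar \<epsilon>))) c0"
    if "\<epsilon> \<in> {0<..<\<epsilon>0}" "is_solution f L b \<epsilon> x \<mu>" for \<epsilon> x \<mu>
    by (rule solution_dissipative_pair) (use that assms(4,5,12) grad L_nonneg in auto)
  \<comment> \<open>\<open>\<alpha>\<close> is chosen before the solution and depends only on
    \<open>\<epsilon>\<close> and \<open>K\<close>. A global constant thus gives a uniform rate,
    while a local one serves a single trajectory.\<close>
  have decay: "\<exists>\<alpha>>0. \<forall>x \<mu>. is_solution f L b \<epsilon> x \<mu> \<longrightarrow>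
      (\<forall>t\<ge>0. norm (gradient f (x t) - gradient f (xbar \<epsilon>)) \<le> K * norm (x t - xbar \<epsilon>)) \<longrightarrow>
      (\<forall>t\<ge>0. norm (x t - xbar \<epsilon>) + norm (\<mu> t - \<mu>bar \<epsilon>)
        \<le> 3 * exp (- \<alpha> * t) * (norm (x 0 - xbar \<epsilon>) + norm (\<mu> 0 - \<mu>bar \<epsilon>)))"
    if \<epsilon>: "\<epsilon> \<in> {0<..<\<epsilon>0}" for \<epsilon> K
  proof -
    have "bounded_linear (\<lambda>v. (1/\<epsilon>) *\<^sub>R (L *v v))"
      by (intro bounded_linear_scaleR_right[THEN bounded_linear_compose]
          matrix_vector_mul_bounded_linear)
    then obtain l where "\<And>v. norm ((1/\<epsilon>) *\<^sub>R (L *v v)) \<le> norm v * l"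
      using bounded_linear.bounded by blast
    then have l: "norm ((1/\<epsilon>) *\<^sub>R (L *v v)) \<le> l * norm v" for v
      by (simp only: mult.commute[of l])
    \<comment> \<open>The largest value allowed by the two upper bounds on \<open>\<delta>\<close>
      in \<open>exponential_decay\<close>.\<close>
    define \<delta> where "\<delta> = min (1/2) (c0 / (2 + (K + l)\<^sup>2))"
    have pos: "0 < 2 + (K + l)\<^sup>2"
      by (simp add: add_pos_nonneg)
    have "\<delta> \<le> c0 / (2 + (K + l)\<^sup>2)"
      by (simp add: \<delta>_def)
    then have "\<delta> * (2 + (K + l)\<^sup>2) \<le> c0"
      using pos by (simp only: pos_le_divide_eq)
    moreover have "0 < \<delta>"
      using \<open>c0 > 0\<close> pos by (simp add: \<delta>_def)
    moreover have "\<delta> \<le> 1/2"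
      by (simp only: \<delta>_def min.cobounded1)
    ultimately have \<delta>: "0 < \<delta>" "\<delta> \<le> 1/2" "\<delta> * (2 + (K + l)\<^sup>2) \<le> c0"
      by simp_all
    show ?thesis
    proof (intro exI[of _ "\<delta>/4"] conjI allI impI)
      fix x \<mu> t
      assume "is_solution f L b \<epsilon> x \<mu>"
        and "\<forall>t\<ge>0. norm (gradient f (x t) - gradient f (xbar \<epsilon>)) \<le> K * norm (x t - xbar \<epsilon>)"
        and "0 \<le> (t::real)"
      then show "norm (x t - xbar \<epsilon>) + norm (\<mu> t - \<mu>bar \<epsilon>)
          \<le> 3 * exp (- (\<delta>/4) * t) * (norm (x 0 - xbar \<epsilon>) + norm (\<mu> 0 - \<mu>bar \<epsilon>))"
        by (intro dissipative_pair.exponential_decay[OF pair[OF \<epsilon>], where K = K and l = l])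
          (use l \<delta> in auto)
    qed (use \<delta> in simp)
  qed
  have conv: "((\<lambda>t. (x t, \<mu> t)) \<longlongrightarrow> (xbar \<epsilon>, \<mu>bar \<epsilon>)) at_top"
    if \<epsilon>: "\<epsilon> \<in> {0<..<\<epsilon>0}" and sol: "is_solution f L b \<epsilon> x \<mu>" for \<epsilon> x \<mu>
  proof -
    interpret dissipative_pair "\<lambda>t. x t - xbar \<epsilon>" "\<lambda>t. \<mu> t - \<mu>bar \<epsilon>"
      "\<lambda>t. gradient f (x t) - gradient f (xbar \<epsilon>)" "\<lambda>t. (1/\<epsilon>) *\<^sub>R (L *v (\<mu> t - \<mu>bar \<epsilon>))" c0
      by (rule pair[OF that])
    \<comment> \<open>\<open>r\<close> is the square root of the initial energy; as the energy never
      grows, \<open>x\<close> stays within distance \<open>r\<close> of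
      \<open>xbar \<epsilon>\<close>.\<close>
    define r where "r = sqrt ((x 0 - xbar \<epsilon>) \<bullet> (x 0 - xbar \<epsilon>) + (\<mu> 0 - \<mu>bar \<epsilon>) \<bullet> (\<mu> 0 - \<mu>bar \<epsilon>))"
    have ball: "x t \<in> cball (xbar \<epsilon>) r" if "t \<ge> 0" for t
    proof -
      have "(norm (x t - xbar \<epsilon>))\<^sup>2
          \<le> (x 0 - xbar \<epsilon>) \<bullet> (x 0 - xbar \<epsilon>) + (\<mu> 0 - \<mu>bar \<epsilon>) \<bullet> (\<mu> 0 - \<mu>bar \<epsilon>)"
        using energy_le[OF that] inner_ge_zero[of "\<mu> t - \<mu>bar \<epsilon>"]
        unfolding power2_norm_eq_inner by linarith
      then have "norm (x t - xbar \<epsilon>) \<le> r"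
        unfolding r_def by (rule real_le_rsqrt)
      then show ?thesis
        by (simp add: dist_norm norm_minus_commute)
    qed
    \<comment> \<open>This puts the centre \<open>xbar \<epsilon>\<close> itself in the ball, so the
      Lipschitz bound applies to the pair \<open>x t\<close>,
      \<open>xbar \<epsilon>\<close>.\<close>
    have "r \<ge> 0"
      by (simp add: r_def)
    \<comment> \<open>\<open>K\<close> depends on the initial point through \<open>r\<close>, so the
      rate obtained here need not be uniform; for convergence this does no harm.\<close>
    obtain K where K: "K-lipschitz_on (cball (xbar \<epsilon>) r) (gradient f)"
      using assms(6) by (rule twice_continuously_differentiable_gradient_lipschitz_cball)
    have "norm (gradient f (x t) - gradient f (xbar \<epsilon>)) \<le> K * norm (x t - xbar \<epsilon>)" if "t \<ge> 0" for t
      using lipschitz_on_normD[OF K ball[OF that]] \<open>r \<ge> 0\<close> by simp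
    then obtain \<alpha> where "\<alpha> > 0" and \<alpha>: "\<And>t. t \<ge> 0 \<Longrightarrow> norm (x t - xbar \<epsilon>) + norm (\<mu> t - \<mu>bar \<epsilon>)
        \<le> 3 * exp (- \<alpha> * t) * (norm (x 0 - xbar \<epsilon>) + norm (\<mu> 0 - \<mu>bar \<epsilon>))"
      using decay[OF \<epsilon>, of K] sol by blast
    let ?B = "\<lambda>t. 3 * exp (- \<alpha> * t) * (norm (x 0 - xbar \<epsilon>) + norm (\<mu> 0 - \<mu>bar \<epsilon>))"
    have "filterlim (\<lambda>t. - \<alpha> * t) at_bot at_top"
      using \<open>\<alpha> > 0\<close> by (intro filterlim_tendsto_neg_mult_at_bot[OF tendsto_const _ filterlim_ident]) simp
    then have "((\<lambda>t. exp (- \<alpha> * t)) \<longlongrightarrow> 0) at_top"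
      by (rule filterlim_compose[OF exp_at_bot])
    then have lim: "(?B \<longlongrightarrow> 0) at_top"
      by (intro tendsto_mult_left_zero tendsto_mult_right_zero)
    have "((\<lambda>t. x t - xbar \<epsilon>) \<longlongrightarrow> 0) at_top"
    proof (rule Lim_null_comparison[OF _ lim])
      show "\<forall>\<^sub>F t in at_top. norm (x t - xbar \<epsilon>) \<le> ?B t"
        using eventually_ge_at_top[of 0]
        by eventually_elim (use \<alpha> norm_ge_zero order_trans add_increasing2 in \<open>smt (verit)\<close>)
    qed
    moreover have "((\<lambda>t. \<mu> t - \<mu>bar \<epsilon>) \<longlongrightarrow> 0) at_top"
    proof (rule Lim_null_comparison[OF _ lim])
      show "\<forall>\<^sub>F t in at_top. norm (\<mu> t - \<mu>bar \<epsilon>) \<le> ?B t"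
        using eventually_ge_at_top[of 0]
        by eventually_elim (use \<alpha> norm_ge_zero order_trans add_increasing2 in \<open>smt (verit)\<close>)
    qed
    ultimately show ?thesis
      by (intro tendsto_Pair) (simp_all add: LIM_zero_iff)
  qed
  have exp_conv: "\<exists>C>0. \<exists>\<alpha>>0. \<forall>x \<mu>. is_solution f L b \<epsilon> x \<mu> \<longrightarrow>
      (\<forall>t\<ge>0. norm (x t - xbar \<epsilon>) + norm (\<mu> t - \<mu>bar \<epsilon>)
        \<le> C * exp (- \<alpha> * t) * (norm (x 0 - xbar \<epsilon>) + norm (\<mu> 0 - \<mu>bar \<epsilon>)))"
    if \<epsilon>: "\<epsilon> \<in> {0<..<\<epsilon>0}" and \<kappa>: "\<kappa>-lipschitz_on UNIV (gradient f)" for \<epsilon> \<kappa>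
  proof -
    have "norm (gradient f y - gradient f z) \<le> \<kappa> * norm (y - z)" for y z
      using lipschitz_on_normD[OF \<kappa>] by simp
    then show ?thesis
      using decay[OF \<epsilon>, of \<kappa>] by (intro exI[of _ 3]) auto
  qed
  show ?thesis
    using conv exp_conv by blast
qed

end
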